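(* Let $E_1,\dots,E_m$ and $F$ be Banach spaces. Then $\mathcal{L}_{DP}^{(\mathrm{CH1})}(E_1,\dots,E_m;F)=\mathcal{L}_{DP}^{\mathrm{ev}}(E_1,\dots,E_m;F)$.
   Context: Banach spaces are over $\mathbb{K}=\mathbb{R}$ or $\mathbb{C}$; $\overset{w}{\to}$ denotes weak convergence of sequences; $\mathcal{L}(E_1,\dots,E_m;F)$ is the space of continuous $m$-linear operators. $T\in\mathcal{L}(E_1,\dots,E_m;F)$ is Dunford–Pettis (at the origin), $T\in\mathcal{L}_{DP}(E_1,\dots,E_m;F)$, if for all sequences $x_j^{(i)}\overset{w}{\to}0$ in $E_i$ ($i=1,\dots,m$) one has $\|T(x_j^{(1)},\dots,x_j^{(m)})\|\to0$. For $m=1$ this is the class $\mathcal{DP}$ of Dunford–Pettis linear operators. $T\in\mathcal{L}_{DP}^{\mathrm{ev}}(E_1,\dots,E_m;F)$ (Dunford–Pettis at every point) if for all $(a_1,\dots,a_m)\in E_1\times\cdots\times E_m$ and all sequences $x_j^{(i)}\overset{w}{\to}a_i$ in $E_i$ ($i=1,\dots,m$), $T(x_j^{(1)},\dots,x_j^{(m)})\to T(a_1,\dots,a_m)$ in norm. For $T\in\mathcal{L}(E_1,\dots,E_m;F)$, $m\ge2$, and $a_i\in E_i$, $T_{a_i}$ is the $(m-1)$-linear operator obtained from $T$ by fixing the $i$-th variable equal to $a_i$. $\mathcal{L}_{DP}^{(\mathrm{CH1})}$ is the class of Dunford–Pettis multilinear operators satisfying condition (CH1), defined recursively: for $m=1$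 it is $\mathcal{DP}$; for $m\ge2$, $T\in\mathcal{L}_{DP}^{(\mathrm{CH1})}(E_1,\dots,E_m;F)$ if and only if $T\in\mathcal{L}_{DP}(E_1,\dots,E_m;F)$ and, for every $i\in\{1,\dots,m\}$ and every $a_i\in E_i$, $T_{a_i}$ belongs to $\mathcal{L}_{DP}^{(\mathrm{CH1})}$ (as an $(m-1)$-linear operator on the remaining spaces). Equivalently, $T$ and every operator obtained from $T$ by fixing any proper subset of its variables are Dunford–Pettis at the origin. *)

theory Defs
  imports "HOL-Analysis.Analysis" "HOL-Algebra.Algebraic_Closure_Type"
begin

section \<open>Banach spaces over a type of scalars\<close>

text \<open>
  The distribution has no type class of complex normed spaces, and a family of Banach spaces
  indexed by a number needs its members in one type. Hence normed spaces are structures with a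
  carrier, extending the modules of HOL-Algebra by a norm. The spaces of a family share only the
  type of their elements: each has its own carrier, operations and norm. Any finite family can be
  brought into this form by tagging elements with a sum type.

  The scalars are a type of class \<^class>\<open>real_normed_field\<close>. Its norm is multiplicative, so by
  the Gelfand-Mazur theorem such a type is isometrically isomorphic, as a real normed algebra,
  to the reals or to the complex numbers.
\<close>

record ('k, 'a) normed_space = "('k, 'a) module" +
  nrm :: "'a \<Rightarrow> real"

definition is_normed_space :: "('k::real_normed_field, 'a) normed_space \<Rightarrow> bool" where
  "is_normed_space E \<longleftrightarrow>
     Module.module (ring_of_type_algebra :: 'k ring) E \<and>
     (\<forall>x\<in>carrier E. 0 \<le> nrm E x) \<and>
     (\<forall>x\<in>carrier E. nrm E x = 0 \<longleftrightarrow> x = \<zero>\<^bsub>E\<^esub>) \<and>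
     (\<forall>c. \<forall>x\<in>carrier E. nrm E (c \<odot>\<^bsub>E\<^esub> x) = norm c * nrm E x) \<and>
     (\<forall>x\<in>carrier E. \<forall>y\<in>carrier E. nrm E (x \<oplus>\<^bsub>E\<^esub> y) \<le> nrm E x + nrm E y)"

text \<open>
  The value zero off the carrier is arbitrary; \<^locale>\<open>Metric_space\<close> asks for a symmetric,
  nonnegative function on the whole type.
\<close>

definition ndist :: "('k, 'a) normed_space \<Rightarrow> 'a \<Rightarrow> 'a \<Rightarrow> real" where
  "ndist E x y = (if x \<in> carrier E \<and> y \<in> carrier E then nrm E (x \<ominus>\<^bsub>E\<^esub> y) else 0)"

lemma Metric_space_ndist:
  fixes E :: "('k::real_normed_field, 'a) normed_space"
  assumes "is_normed_space E"
  shows "Metric_space (carrier E) (ndist E)"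
proof -
  interpret M: Module.module "ring_of_type_algebra :: 'k ring" E
    using assms by (simp add: is_normed_space_def)
  have sym: "nrm E (x \<ominus>\<^bsub>E\<^esub> y) = nrm E (y \<ominus>\<^bsub>E\<^esub> x)" if "x \<in> carrier E" "y \<in> carrier E" for x y
  proof -
    let ?u = "\<ominus>\<^bsub>ring_of_type_algebra\<^esub> (1::'k)"
    have one: "(\<one>\<^bsub>ring_of_type_algebra\<^esub> :: 'k) = 1"
      by (simp add: ring_of_type_algebra_def)
    have "?u \<oplus>\<^bsub>ring_of_type_algebra\<^esub> 1 = \<zero>\<^bsub>ring_of_type_algebra\<^esub>"
      by (rule M.R.l_neg) (simp add: ring_of_type_algebra_def)
    then have "?u + 1 = 0"
      by (simp add: ring_of_type_algebra_def)
    then have u: "?u = - 1"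
      by (simp add: eq_neg_iff_add_eq_0)
    have d: "x \<ominus>\<^bsub>E\<^esub> y \<in> carrier E"
      using that by simp
    have "y \<ominus>\<^bsub>E\<^esub> x = \<ominus>\<^bsub>E\<^esub> (x \<ominus>\<^bsub>E\<^esub> y)"
      using that by (simp add: M.minus_eq M.minus_add M.a_comm)
    also have "\<dots> = (- 1 :: 'k) \<odot>\<^bsub>E\<^esub> (x \<ominus>\<^bsub>E\<^esub> y)"
      using M.smult_l_minus[of 1, OF _ d] M.smult_one[OF d]
      unfolding one u by (simp add: ring_of_type_algebra_def)
    finally show ?thesis
      using assms d by (simp add: is_normed_space_def)
  qed
  show ?thesis
  proof
    show "0 \<le> ndist E x y" for x y
      using assms by (simp add: ndist_def is_normed_space_def)
    show "ndist E x y = ndist E y x" for x y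
      using sym by (simp add: ndist_def)
    show "ndist E x y = 0 \<longleftrightarrow> x = y" if "x \<in> carrier E" "y \<in> carrier E" for x y
    proof -
      have "x \<ominus>\<^bsub>E\<^esub> y = \<zero>\<^bsub>E\<^esub> \<longleftrightarrow> x = y"
        using that M.minus_equality[of x "\<ominus>\<^bsub>E\<^esub> y"] by (auto simp: M.minus_eq M.r_neg)
      then show ?thesis
        using assms that by (simp add: ndist_def is_normed_space_def)
    qed
    show "ndist E x z \<le> ndist E x y + ndist E y z"
      if "x \<in> carrier E" "y \<in> carrier E" "z \<in> carrier E" for x y z
    proof -
      have "x \<ominus>\<^bsub>E\<^esub> z = (x \<ominus>\<^bsub>E\<^esub> y) \<oplus>\<^bsub>E\<^esub> (y \<ominus>\<^bsub>E\<^esub> z)"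
        using that by (simp add: M.minus_eq M.a_assoc M.r_neg1)
      then show ?thesis
        using assms that by (simp add: ndist_def is_normed_space_def)
    qed
  qed
qed

abbreviation ntopology :: "('k, 'a) normed_space \<Rightarrow> 'a topology" where
  "ntopology E \<equiv> Metric_space.mtopology (carrier E) (ndist E)"

definition is_banach_space :: "('k::real_normed_field, 'a) normed_space \<Rightarrow> bool" where
  "is_banach_space E \<longleftrightarrow>
     is_normed_space E \<and> Metric_space.mcomplete (carrier E) (ndist E)"

section \<open>Weak convergence of sequences\<close>

definition dual_space :: "('k::real_normed_field, 'a) normed_space \<Rightarrow> ('a \<Rightarrow> 'k) set" where
  "dual_space E =
     {\<phi>. (\<forall>x\<in>carrier E. \<forall>y\<in>carrier E. \<phi> (x \<oplus>\<^bsub>E\<^esub> y) = \<phi> x + \<phi> y) \<and>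
         (\<forall>c. \<forall>x\<in>carrier E. \<phi> (c \<odot>\<^bsub>E\<^esub> x) = c * \<phi> x) \<and>
         continuous_map (ntopology E) euclidean \<phi>}"

definition weakly_converges ::
  "('k::real_normed_field, 'a) normed_space \<Rightarrow> (nat \<Rightarrow> 'a) \<Rightarrow> 'a \<Rightarrow> bool" where
  "weakly_converges E x a \<longleftrightarrow>
     range x \<subseteq> carrier E \<and> a \<in> carrier E \<and>
     (\<forall>\<phi>\<in>dual_space E. (\<lambda>j. \<phi> (x j)) \<longlonglongrightarrow> \<phi> a)"

section \<open>Continuous multilinear operators\<close>

text \<open>
  The factors are indexed by a finite set \<open>I\<close> of naturals rather than by an initial segment, so
  that fixing the variable \<open>i\<close> gives an operator on the factors in \<open>I - {i}\<close>, with no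
  renumbering. Operators are extensional, hence determined by their values on the product.
\<close>

abbreviation prod_carrier :: "(nat \<Rightarrow> ('k, 'a) normed_space) \<Rightarrow> nat set \<Rightarrow> (nat \<Rightarrow> 'a) set" where
  "prod_carrier E I \<equiv> (\<Pi>\<^sub>E i\<in>I. carrier (E i))"

definition multilin_ops ::
  "(nat \<Rightarrow> ('k, 'a) normed_space) \<Rightarrow> nat set \<Rightarrow> ('k, 'b) normed_space \<Rightarrow>
   ((nat \<Rightarrow> 'a) \<Rightarrow> 'b) set" where
  "multilin_ops E I F =
     {T \<in> prod_carrier E I \<rightarrow>\<^sub>E carrier F.
        (\<forall>x\<in>prod_carrier E I. \<forall>i\<in>I. \<forall>y\<in>carrier (E i). \<forall>z\<in>carrier (E i).
           T (x(i := y \<oplus>\<^bsub>E i\<^esub> z)) = T (x(i := y)) \<oplus>\<^bsub>F\<^esub> T (x(i := z))) \<and>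
        (\<forall>x\<in>prod_carrier E I. \<forall>i\<in>I. \<forall>c. \<forall>y\<in>carrier (E i).
           T (x(i := c \<odot>\<^bsub>E i\<^esub> y)) = c \<odot>\<^bsub>F\<^esub> T (x(i := y))) \<and>
        continuous_map (product_topology (\<lambda>i. ntopology (E i)) I) (ntopology F) T}"

definition fix_var ::
  "(nat \<Rightarrow> ('k, 'a) normed_space) \<Rightarrow> nat set \<Rightarrow> nat \<Rightarrow> 'a \<Rightarrow>
   ((nat \<Rightarrow> 'a) \<Rightarrow> 'b) \<Rightarrow> (nat \<Rightarrow> 'a) \<Rightarrow> 'b" where
  "fix_var E I i a T = (\<lambda>x\<in>prod_carrier E (I - {i}). T (x(i := a)))"

section \<open>Dunford-Pettis multilinear operators\<close>

text \<open>In the sequences below, \<open>x i j\<close> is the \<open>j\<close>-th term of the sequence in \<open>E i\<close>.\<close>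

definition DP_origin ::
  "(nat \<Rightarrow> ('k::real_normed_field, 'a) normed_space) \<Rightarrow> nat set \<Rightarrow> ('k, 'b) normed_space \<Rightarrow>
   ((nat \<Rightarrow> 'a) \<Rightarrow> 'b) set" where
  "DP_origin E I F =
     {T \<in> multilin_ops E I F.
        \<forall>x. (\<forall>i\<in>I. weakly_converges (E i) (x i) \<zero>\<^bsub>E i\<^esub>) \<longrightarrow>
            (\<lambda>j. nrm F (T (\<lambda>i\<in>I. x i j))) \<longlonglongrightarrow> 0}"

definition DP_everywhere ::
  "(nat \<Rightarrow> ('k::real_normed_field, 'a) normed_space) \<Rightarrow> nat set \<Rightarrow> ('k, 'b) normed_space \<Rightarrow>
   ((nat \<Rightarrow> 'a) \<Rightarrow> 'b) set" where
  "DP_everywhere E I F =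
     {T \<in> multilin_ops E I F.
        \<forall>a\<in>prod_carrier E I. \<forall>x. (\<forall>i\<in>I. weakly_converges (E i) (x i) (a i)) \<longrightarrow>
            (\<lambda>j. nrm F (T (\<lambda>i\<in>I. x i j) \<ominus>\<^bsub>F\<^esub> T a)) \<longlonglongrightarrow> 0}"

text \<open>
  The recursion ends at operators of one variable, where only the Dunford-Pettis property remains.
\<close>

function DP_CH1 ::
  "(nat \<Rightarrow> ('k::real_normed_field, 'a) normed_space) \<Rightarrow> nat set \<Rightarrow> ('k, 'b) normed_space \<Rightarrow>
   ((nat \<Rightarrow> 'a) \<Rightarrow> 'b) set" where
  "DP_CH1 E I F =
     (if card I \<ge> 2
      then {T \<in> DP_origin E I F.
              \<forall>i\<in>I. \<forall>a\<in>carrier (E i). fix_var E I i a T \<in> DP_CH1 E (I - {i}) F}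
      else DP_origin E I F)"
  by pat_completeness auto
termination
  by (relation "Wellfounded.measure (\<lambda>(E, I, F). card I)") (auto intro!: card_Diff1_less card_ge_0_finite)

declare DP_CH1.simps [simp del]

end

(*
  Sketch of the harder inclusion. Let T satisfy (CH1) and let y_i tend weakly to b_i. If b_i is
  nonzero, split y_i = (y_i - b_i) + b_i. The second summand fixes the variable i, so by induction
  on the number of variables its contribution tends to T b. The first summand replaces the limit
  b_i by 0, so by induction on the number of nonzero limits its contribution tends to
  T (b(i := 0)) = 0. When all limits vanish, T being Dunford-Pettis at the origin applies.
*)
theory Submission
  imports Defs
begin

section \<open>Normed spaces and weakly convergent sequences\<close>

lemma normed_space_module:
  "is_normed_space (E :: ('k::real_normed_field, 'a) normed_space) \<Longrightarrow>
    Module.module (ring_of_type_algebra :: 'k ring) E"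
  by (simp add: is_normed_space_def)

lemma smult_closed_normed_space:
  fixes E :: "('k::real_normed_field, 'a) normed_space"
  assumes "is_normed_space E" "y \<in> carrier E"
  shows "c \<odot>\<^bsub>E\<^esub> y \<in> carrier E"
proof -
  interpret Module.module "ring_of_type_algebra :: 'k ring" E
    using assms(1) by (rule normed_space_module)
  show ?thesis
    using assms(2) by (intro smult_closed) (auto simp: ring_of_type_algebra_def)
qed

lemma topspace_ntopology:
  "is_normed_space (E :: ('k::real_normed_field, 'a) normed_space) \<Longrightarrow>
    topspace (ntopology E) = carrier E"
  by (simp add: Metric_space.topspace_mtopology Metric_space_ndist)

lemma weakly_converges_const:
  "a \<in> carrier E \<Longrightarrow> weakly_converges E (\<lambda>_. a) a"
  by (auto simp: weakly_converges_def)

text \<open>Each functional in \<open>dual_space E\<close> is additive, so its values on the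
  differences are the differences of its values. This lemma lets one sequence of an argument be
  recentred at the origin.\<close>

lemma weakly_converges_minus:
  fixes E :: "('k::real_normed_field, 'a) normed_space"
  assumes E: "is_normed_space E" and x: "weakly_converges E x a"
  shows "weakly_converges E (\<lambda>j. x j \<ominus>\<^bsub>E\<^esub> a) \<zero>\<^bsub>E\<^esub>"
proof -
  interpret Module.module "ring_of_type_algebra :: 'k ring" E
    using E by (rule normed_space_module)
  have a: "a \<in> carrier E" and xc: "x j \<in> carrier E" for j
    using x by (auto simp: weakly_converges_def)
  have "(\<lambda>j. \<phi> (x j \<ominus>\<^bsub>E\<^esub> a)) \<longlonglongrightarrow> \<phi> \<zero>\<^bsub>E\<^esub>" if "\<phi> \<in> dual_space E" for \<phi>
  proof -
    have add: "\<phi> (u \<oplus>\<^bsub>E\<^esub> v) = \<phi> u + \<phi> v" if "u \<in> carrier E" "v \<in> carrier E" for u v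
      using \<open>\<phi> \<in> dual_space E\<close> that by (simp add: dual_space_def)
    \<comment> \<open>Subtraction is read off from additivity applied to
      \<open>x j = (x j - a) + a\<close>.\<close>
    have "\<phi> (x j \<ominus>\<^bsub>E\<^esub> a) = \<phi> (x j) - \<phi> a" for j
      using add[of "x j \<ominus>\<^bsub>E\<^esub> a" a] a xc[of j] by (simp add: minus_eq a_assoc l_neg)
    moreover have "\<phi> \<zero>\<^bsub>E\<^esub> = 0"
      using add[of "\<zero>\<^bsub>E\<^esub>" "\<zero>\<^bsub>E\<^esub>"] by simp
    moreover have "(\<lambda>j. \<phi> (x j) - \<phi> a) \<longlonglongrightarrow> 0"
      using x that by (auto simp: weakly_converges_def LIM_zero_iff)
    ultimately show ?thesis
      by simp
  qed
  then show ?thesis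
    using a xc by (auto simp: weakly_converges_def)
qed

lemma weakly_converges_in_carrier:
  "weakly_converges E x a \<Longrightarrow> x j \<in> carrier E"
  by (auto simp: weakly_converges_def)

lemma weakly_converges_in_prod_carrier:
  assumes "\<And>i. i \<in> I \<Longrightarrow> weakly_converges (E i) (x i) (a i)"
  shows "(\<lambda>i\<in>I. x i j) \<in> prod_carrier E I"
  using weakly_converges_in_carrier[OF assms] by auto

section \<open>Multilinear operators and fixing one variable\<close>

lemma multilin_ops_closed:
  "T \<in> multilin_ops E I F \<Longrightarrow> x \<in> prod_carrier E I \<Longrightarrow> T x \<in> carrier F"
  by (auto simp: multilin_ops_def)

lemma multilin_ops_add:
  assumes "T \<in> multilin_ops E I F" "x \<in> prod_carrier E I" "i \<in> I"
    and "y \<in> carrier (E i)" "z \<in> carrier (E i)"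
  shows "T (x(i := y \<oplus>\<^bsub>E i\<^esub> z)) = T (x(i := y)) \<oplus>\<^bsub>F\<^esub> T (x(i := z))"
  using assms by (simp add: multilin_ops_def)

lemma prod_carrier_upd:
  assumes "x \<in> prod_carrier E (I - {i})" "i \<in> I" "a \<in> carrier (E i)"
  shows "x(i := a) \<in> prod_carrier E I"
  using assms PiE_fun_upd[of a "\<lambda>i. carrier (E i)" i x "I - {i}"] by (simp add: insert_absorb)

lemma prod_carrier_upd':
  assumes "x \<in> prod_carrier E I" "i \<in> I" "a \<in> carrier (E i)"
  shows "x(i := a) \<in> prod_carrier E I"
  using assms PiE_fun_upd[of a "\<lambda>i. carrier (E i)" i x I] by (simp add: insert_absorb)

text \<open>Writing the zero in slot \<open>i\<close> as zero plus zero, additivity in that slot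
  gives \<open>T x + T x = T x\<close>, and cancellation in \<open>F\<close> finishes.\<close>

lemma multilin_ops_zero:
  fixes E :: "nat \<Rightarrow> ('k::real_normed_field, 'a) normed_space"
    and F :: "('k, 'b) normed_space"
  assumes "is_normed_space (E i)" "is_normed_space F" "T \<in> multilin_ops E I F"
    and "x \<in> prod_carrier E I" "i \<in> I" "x i = \<zero>\<^bsub>E i\<^esub>"
  shows "T x = \<zero>\<^bsub>F\<^esub>"
proof -
  interpret F: Module.module "ring_of_type_algebra :: 'k ring" F
    using assms(2) by (rule normed_space_module)
  interpret E: Module.module "ring_of_type_algebra :: 'k ring" "E i"
    using assms(1) by (rule normed_space_module)
  have "x(i := \<zero>\<^bsub>E i\<^esub>) = x"
    using assms(6) by (metis fun_upd_triv)
  then have "T x \<oplus>\<^bsub>F\<^esub> T x = T x"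
    using multilin_ops_add[OF assms(3,4,5) E.zero_closed E.zero_closed] by simp
  then show ?thesis
    using multilin_ops_closed[OF assms(3,4)] by simp
qed

text \<open>Linearity in a remaining slot \<open>k\<close> is inherited because updates at
  \<open>k\<close> and at \<open>i\<close> commute. Continuity is inherited because inserting the
  constant \<open>a\<close> in slot \<open>i\<close> is a continuous map between the
  products.\<close>

lemma fix_var_multilin_ops:
  fixes E :: "nat \<Rightarrow> ('k::real_normed_field, 'a) normed_space"
    and F :: "('k, 'b) normed_space"
  assumes E: "\<And>i. i \<in> I \<Longrightarrow> is_normed_space (E i)"
    and T: "T \<in> multilin_ops E I F" and i: "i \<in> I" and a: "a \<in> carrier (E i)"
  shows "fix_var E I i a T \<in> multilin_ops E (I - {i}) F"
proof -
  let ?J = "I - {i}"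
  let ?P = "\<lambda>I. product_topology (\<lambda>i. ntopology (E i)) I"
  have top: "topspace (?P ?J) = prod_carrier E ?J"
    unfolding topspace_product_topology using E by (intro PiE_cong) (simp add: topspace_ntopology)
  have upd: "x(i := a) \<in> prod_carrier E I" if "x \<in> prod_carrier E ?J" for x
    using prod_carrier_upd[where E = E and a = a] that i a by blast
  \<comment> \<open>The order of the updates matters: with \<open>k\<close> outermost, the linearity
    of \<open>T\<close> in slot \<open>k\<close> applies at the base point \<open>x(i := a)\<close>.
    The swap is legitimate since \<open>k\<close> differs from \<open>i\<close>.\<close>
  have eq: "fix_var E I i a T (x(k := y)) = T ((x(i := a))(k := y))"
    if "x \<in> prod_carrier E ?J" "k \<in> ?J" "y \<in> carrier (E k)" for x k y
    using that prod_carrier_upd'[where E = E and I = ?J and i = k and x = x and a = y] by (simp add: fix_var_def fun_upd_twist)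
  have "fix_var E I i a T \<in> prod_carrier E ?J \<rightarrow>\<^sub>E carrier F"
    using multilin_ops_closed[OF T] upd
    by (auto simp: fix_var_def)
  moreover have "fix_var E I i a T (x(k := y \<oplus>\<^bsub>E k\<^esub> z)) =
      fix_var E I i a T (x(k := y)) \<oplus>\<^bsub>F\<^esub> fix_var E I i a T (x(k := z))"
    if "x \<in> prod_carrier E ?J" "k \<in> ?J" "y \<in> carrier (E k)" "z \<in> carrier (E k)" for x k y z
  proof -
    interpret Module.module "ring_of_type_algebra :: 'k ring" "E k"
      using E that by (simp add: normed_space_module)
    show ?thesis
      using that multilin_ops_add[OF T upd[OF that(1)]] by (simp add: eq)
  qed
  moreover have "fix_var E I i a T (x(k := c \<odot>\<^bsub>E k\<^esub> y)) = c \<odot>\<^bsub>F\<^esub> fix_var E I i a T (x(k := y))"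
    if "x \<in> prod_carrier E ?J" "k \<in> ?J" "y \<in> carrier (E k)" for x k c y
    using T that smult_closed_normed_space[of "E k" y c] E[of k] upd[OF that(1)]
    by (simp add: eq multilin_ops_def)
  moreover have "continuous_map (?P ?J) (ntopology F) (fix_var E I i a T)"
  proof -
    \<comment> \<open>Continuity into the product is checked by coordinates: coordinate
      \<open>i\<close> is constant, every other one is a projection.\<close>
    have "continuous_map (?P ?J) (ntopology (E k)) (\<lambda>x. (x(i := a)) k)" if "k \<in> I" for k
    proof (cases "k = i")
      case True
      then show ?thesis
        using a E i by (simp add: topspace_ntopology)
    next
      case False
      then show ?thesis
        using that continuous_map_product_projection[of k ?J "\<lambda>i. ntopology (E i)"] by simp
    qed
    moreover have "(\<lambda>x. x(i := a)) ` topspace (?P ?J) \<subseteq> extensional I"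
      using upd unfolding top by (auto simp: PiE_iff)
    ultimately have "continuous_map (?P ?J) (?P I) (\<lambda>x. x(i := a))"
      by (simp add: continuous_map_componentwise)
    moreover have "continuous_map (?P I) (ntopology F) T"
      using T by (simp add: multilin_ops_def)
    ultimately have "continuous_map (?P ?J) (ntopology F) (T \<circ> (\<lambda>x. x(i := a)))"
      by (rule continuous_map_compose)
    then show ?thesis
      by (rule continuous_map_eq) (simp only: top fix_var_def restrict_apply comp_apply if_True)
  qed
  ultimately show ?thesis
    by (simp add: multilin_ops_def)
qed

section \<open>Operators that are Dunford-Pettis at every point: fixed variables and the
  origin\<close>

lemma DP_everywhereD:
  assumes "T \<in> DP_everywhere E I F" "a \<in> prod_carrier E I"
    and "\<And>i. i \<in> I \<Longrightarrow> weakly_converges (E i) (x i) (a i)"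
  shows "(\<lambda>j. nrm F (T (\<lambda>i\<in>I. x i j) \<ominus>\<^bsub>F\<^esub> T a)) \<longlonglongrightarrow> 0"
  using assms by (simp add: DP_everywhere_def)

lemma restrict_remove_upd:
  "i \<in> I \<Longrightarrow> (restrict f (I - {i}))(i := a) = (restrict f I)(i := a)"
  by (auto simp: fun_eq_iff)

lemma fix_var_DP_everywhere:
  fixes E :: "nat \<Rightarrow> ('k::real_normed_field, 'a) normed_space"
    and F :: "('k, 'b) normed_space"
  assumes E: "\<And>i. i \<in> I \<Longrightarrow> is_normed_space (E i)"
    and T: "T \<in> DP_everywhere E I F" and i: "i \<in> I" and a: "a \<in> carrier (E i)"
  shows "fix_var E I i a T \<in> DP_everywhere E (I - {i}) F"
proof -
  have TM: "T \<in> multilin_ops E I F"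
    using T by (simp add: DP_everywhere_def)
  have "(\<lambda>j. nrm F (fix_var E I i a T (\<lambda>k\<in>I - {i}. x k j) \<ominus>\<^bsub>F\<^esub> fix_var E I i a T b)) \<longlonglongrightarrow> 0"
    if b: "b \<in> prod_carrier E (I - {i})"
      and x: "\<forall>k\<in>I - {i}. weakly_converges (E k) (x k) (b k)" for b x
  proof -
    let ?y = "x(i := \<lambda>_. a)"
    have "(\<lambda>j. nrm F (T (\<lambda>k\<in>I. ?y k j) \<ominus>\<^bsub>F\<^esub> T (b(i := a)))) \<longlonglongrightarrow> 0"
    proof (rule DP_everywhereD[OF T])
      show "b(i := a) \<in> prod_carrier E I"
        using b i a by (rule prod_carrier_upd)
      show "weakly_converges (E k) (?y k) ((b(i := a)) k)" if "k \<in> I" for k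
        using x that a by (simp add: weakly_converges_const)
    qed
    moreover have "(\<lambda>k\<in>I - {i}. x k j)(i := a) = (\<lambda>k\<in>I. ?y k j)" for j
      using i by (auto simp: fun_eq_iff)
    moreover have "(\<lambda>k\<in>I - {i}. x k j) \<in> prod_carrier E (I - {i})" for j
      using x by (intro weakly_converges_in_prod_carrier) auto
    ultimately show ?thesis
      using b by (simp add: fix_var_def)
  qed
  then show ?thesis
    using fix_var_multilin_ops[OF E TM i a] by (simp add: DP_everywhere_def)
qed

text \<open>Take all limits to be zero, where \<open>T\<close> vanishes. The index set must be
  nonempty for this: an operator of no variables is a single vector, possibly nonzero.\<close>

lemma DP_everywhere_subset_DP_origin:
  fixes E :: "nat \<Rightarrow> ('k::real_normed_field, 'a) normed_space"
    and F :: "('k, 'b) normed_space"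
  assumes E: "\<And>i. i \<in> I \<Longrightarrow> is_normed_space (E i)" and F: "is_normed_space F" and "I \<noteq> {}"
  shows "DP_everywhere E I F \<subseteq> DP_origin E I F"
proof
  fix T
  assume T: "T \<in> DP_everywhere E I F"
  then have TM: "T \<in> multilin_ops E I F"
    by (simp add: DP_everywhere_def)
  interpret F: Module.module "ring_of_type_algebra :: 'k ring" F
    using F by (rule normed_space_module)
  \<comment> \<open>Lets the difference with \<open>T ?z\<close>, which is zero, be simplified
    away.\<close>
  have F_minus_zero: "\<ominus>\<^bsub>F\<^esub> \<zero>\<^bsub>F\<^esub> = \<zero>\<^bsub>F\<^esub>"
    using F.r_neg[OF F.zero_closed] by simp
  let ?z = "\<lambda>i\<in>I. \<zero>\<^bsub>E i\<^esub>"
  have "\<zero>\<^bsub>E i\<^esub> \<in> carrier (E i)" if "i \<in> I" for i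
    using abelian_group.axioms(1)[OF Module.module.axioms(2)[OF normed_space_module[OF E[OF that]]]]
    by (rule abelian_monoid.zero_closed)
  then have z: "?z \<in> prod_carrier E I"
    by auto
  obtain i where "i \<in> I"
    using \<open>I \<noteq> {}\<close> by blast
  then have Tz: "T ?z = \<zero>\<^bsub>F\<^esub>"
    by (intro multilin_ops_zero[OF E F TM z]) auto
  have "(\<lambda>j. nrm F (T (\<lambda>i\<in>I. x i j))) \<longlonglongrightarrow> 0"
    if x: "\<forall>i\<in>I. weakly_converges (E i) (x i) \<zero>\<^bsub>E i\<^esub>" for x
  proof -
    have "T (\<lambda>i\<in>I. x i j) \<in> carrier F" for j
      using x by (intro multilin_ops_closed[OF TM] weakly_converges_in_prod_carrier) auto
    then show ?thesis
      using DP_everywhereD[OF T z, of x] x by (simp add: Tz F.minus_eq F_minus_zero)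
  qed
  then show "T \<in> DP_origin E I F"
    using TM by (simp add: DP_origin_def)
qed

section \<open>From the origin to every point\<close>

text \<open>The inner induction, on the number of nonzero limits. The outer induction on the number
  of variables enters only through \<open>fix_ev\<close>, so the lemma serves both for one variable
  and for several.\<close>

lemma DP_everywhereI:
  fixes E :: "nat \<Rightarrow> ('k::real_normed_field, 'a) normed_space"
    and F :: "('k, 'b) normed_space"
  assumes "finite I" and "I \<noteq> {}"
    and E: "\<And>i. i \<in> I \<Longrightarrow> is_normed_space (E i)" and F: "is_normed_space F"
    and T: "T \<in> DP_origin E I F"
    and fix_ev: "\<And>i a. i \<in> I \<Longrightarrow> a \<in> carrier (E i) \<Longrightarrow>
      fix_var E I i a T \<in> DP_everywhere E (I - {i}) F"
  shows "T \<in> DP_everywhere E I F"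
proof -
  have TM: "T \<in> multilin_ops E I F"
    using T by (simp add: DP_origin_def)
  interpret F: Module.module "ring_of_type_algebra :: 'k ring" F
    using F by (rule normed_space_module)
  have F_minus_zero: "\<ominus>\<^bsub>F\<^esub> \<zero>\<^bsub>F\<^esub> = \<zero>\<^bsub>F\<^esub>"
    using F.r_neg[OF F.zero_closed] by simp
  have "(\<lambda>j. nrm F (T (\<lambda>i\<in>I. x i j) \<ominus>\<^bsub>F\<^esub> T b)) \<longlonglongrightarrow> 0"
    if "b \<in> prod_carrier E I" "\<forall>i\<in>I. weakly_converges (E i) (x i) (b i)" for b x
    using that
  \<comment> \<open>Both \<open>b\<close> and \<open>x\<close> are generalized, since the step
    changes the limit and the sequence in one slot together.\<close>
  proof (induction "card {i \<in> I. b i \<noteq> \<zero>\<^bsub>E i\<^esub>}" arbitrary: b x rule: less_induct)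
    case less
    note b = less.prems(1) and x = less.prems(2)
    have xj: "(\<lambda>i\<in>I. x i j) \<in> prod_carrier E I" for j
      using x by (intro weakly_converges_in_prod_carrier) auto
    note Tc = multilin_ops_closed[OF TM]
    show ?case
    proof (cases "\<forall>i\<in>I. b i = \<zero>\<^bsub>E i\<^esub>")
      case True
      obtain i where "i \<in> I"
        using \<open>I \<noteq> {}\<close> by blast
      then have "T b = \<zero>\<^bsub>F\<^esub>"
        using True by (intro multilin_ops_zero[OF E F TM b]) auto
      moreover have "(\<lambda>j. nrm F (T (\<lambda>i\<in>I. x i j))) \<longlonglongrightarrow> 0"
        using T True x by (simp add: DP_origin_def)
      ultimately show ?thesis
        using Tc[OF xj] by (simp add: F.minus_eq F_minus_zero)
    next
      case False
      then obtain i where i: "i \<in> I" "b i \<noteq> \<zero>\<^bsub>E i\<^esub>"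
        by blast
      interpret Ei: Module.module "ring_of_type_algebra :: 'k ring" "E i"
        using E[OF i(1)] by (rule normed_space_module)
      have bi: "b i \<in> carrier (E i)" and xi: "x i j \<in> carrier (E i)" for j
        using PiE_mem[OF b i(1)] weakly_converges_in_carrier[of "E i" "x i" "b i"] x i(1) by auto
      have upd: "y(i := c) \<in> prod_carrier E I"
        if "y \<in> prod_carrier E I" "c \<in> carrier (E i)" for y c
        using prod_carrier_upd'[where E = E and a = c] that i(1) by blast
      \<comment> \<open>\<open>?A\<close> carries the differences in slot \<open>i\<close>, with
        limit zero there; \<open>?B\<close> carries the constant \<open>b i\<close>.\<close>
      let ?u = "x(i := \<lambda>j. x i j \<ominus>\<^bsub>E i\<^esub> b i)"
      let ?A = "\<lambda>j. T (\<lambda>k\<in>I. ?u k j)" and ?B = "\<lambda>j. T ((\<lambda>k\<in>I. x k j)(i := b i))"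
      have b0: "b(i := \<zero>\<^bsub>E i\<^esub>) \<in> prod_carrier E I"
        by (rule upd[OF b Ei.zero_closed])
      have T0: "T (b(i := \<zero>\<^bsub>E i\<^esub>)) = \<zero>\<^bsub>F\<^esub>"
        by (rule multilin_ops_zero[OF E[OF i(1)] F TM b0 i(1)]) simp
      have u: "\<forall>k\<in>I. weakly_converges (E k) (?u k) ((b(i := \<zero>\<^bsub>E i\<^esub>)) k)"
        using x weakly_converges_minus[OF E[OF i(1)], of "x i" "b i"] i(1) by simp
      have Ac: "?A j \<in> carrier F" for j
        using u by (intro Tc weakly_converges_in_prod_carrier[where a = "b(i := \<zero>\<^bsub>E i\<^esub>)"]) blast
      have Bc: "?B j \<in> carrier F" for j
        by (rule Tc[OF upd[OF xj bi]])
      \<comment> \<open>The inclusion is strict because \<open>i\<close> itself drops out; this is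
        where the choice of a nonzero \<open>b i\<close> is used.\<close>
      have "{k \<in> I. (b(i := \<zero>\<^bsub>E i\<^esub>)) k \<noteq> \<zero>\<^bsub>E k\<^esub>} \<subset> {k \<in> I. b k \<noteq> \<zero>\<^bsub>E k\<^esub>}"
        using i by auto
      then have "(\<lambda>j. nrm F (?A j \<ominus>\<^bsub>F\<^esub> T (b(i := \<zero>\<^bsub>E i\<^esub>)))) \<longlonglongrightarrow> 0"
        using \<open>finite I\<close> by (intro less.hyps b0 u psubset_card_mono) auto
      then have A: "(\<lambda>j. nrm F (?A j)) \<longlonglongrightarrow> 0"
        using Ac by (simp add: T0 F.minus_eq F_minus_zero)
      have B: "(\<lambda>j. nrm F (?B j \<ominus>\<^bsub>F\<^esub> T b)) \<longlonglongrightarrow> 0"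
      proof -
        \<comment> \<open>The limit point is \<open>restrict b (I - {i})\<close>, since points of
          the smaller product are extensional on \<open>I - {i}\<close>. Reinserting
          \<open>b i\<close> in slot \<open>i\<close> gives back \<open>b\<close>.\<close>
        have "(\<lambda>j. nrm F (fix_var E I i (b i) T (\<lambda>k\<in>I - {i}. x k j)
            \<ominus>\<^bsub>F\<^esub> fix_var E I i (b i) T (restrict b (I - {i})))) \<longlonglongrightarrow> 0"
          using b x by (intro DP_everywhereD[OF fix_ev[OF i(1) bi]]) (auto simp: PiE_iff)
        moreover have "fix_var E I i (b i) T (restrict b (I - {i})) = T b"
          using b i(1) by (auto simp: fix_var_def restrict_remove_upd PiE_iff extensional_restrict)
        moreover have "fix_var E I i (b i) T (\<lambda>k\<in>I - {i}. x k j) = ?B j" for j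
          using weakly_converges_in_prod_carrier[of "I - {i}" E x b j] x i(1)
          by (simp add: fix_var_def restrict_remove_upd del: restrict_upd)
        ultimately show ?thesis
          by simp
      qed
      have split: "T (\<lambda>k\<in>I. x k j) = ?A j \<oplus>\<^bsub>F\<^esub> ?B j" for j
      proof -
        let ?x = "\<lambda>k\<in>I. x k j"
        have "?x(i := x i j \<ominus>\<^bsub>E i\<^esub> b i) = (\<lambda>k\<in>I. ?u k j)"
          using i(1) by (auto simp: fun_eq_iff)
        moreover have "?x(i := (x i j \<ominus>\<^bsub>E i\<^esub> b i) \<oplus>\<^bsub>E i\<^esub> b i) = ?x"
          using i(1) xi[of j] bi by (auto simp: fun_eq_iff Ei.minus_eq Ei.a_assoc Ei.l_neg)
        moreover have "T (?x(i := (x i j \<ominus>\<^bsub>E i\<^esub> b i) \<oplus>\<^bsub>E i\<^esub> b i)) =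
            T (?x(i := x i j \<ominus>\<^bsub>E i\<^esub> b i)) \<oplus>\<^bsub>F\<^esub> T (?x(i := b i))"
          using xi bi by (intro multilin_ops_add[OF TM xj i(1)]) simp_all
        ultimately show ?thesis
          by simp
      qed
      \<comment> \<open>\<open>T b\<close> is grouped with \<open>?B\<close>, the summand that tends
        to it. The triangle inequality then gives a bound whose two terms tend to zero.\<close>
      have "nrm F (T (\<lambda>k\<in>I. x k j) \<ominus>\<^bsub>F\<^esub> T b) \<le> nrm F (?A j) + nrm F (?B j \<ominus>\<^bsub>F\<^esub> T b)" for j
      proof -
        have "(?A j \<oplus>\<^bsub>F\<^esub> ?B j) \<ominus>\<^bsub>F\<^esub> T b = ?A j \<oplus>\<^bsub>F\<^esub> (?B j \<ominus>\<^bsub>F\<^esub> T b)"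
          using Ac[of j] Bc[of j] Tc[OF b] by (simp add: F.minus_eq F.a_assoc)
        then show ?thesis
          unfolding split using F Ac[of j] Bc[of j] Tc[OF b] by (simp add: is_normed_space_def)
      qed
      moreover have "norm (nrm F (T (\<lambda>k\<in>I. x k j) \<ominus>\<^bsub>F\<^esub> T b)) = nrm F (T (\<lambda>k\<in>I. x k j) \<ominus>\<^bsub>F\<^esub> T b)" for j
        using F Tc[OF xj] Tc[OF b] by (simp add: is_normed_space_def)
      ultimately show ?thesis
        by (intro Lim_null_comparison[OF always_eventually tendsto_add_zero[OF A B]]) simp
    qed
  qed
  then show ?thesis
    using TM by (simp add: DP_everywhere_def)
qed

text \<open>The product over no variables has the single point \<open>\<lambda>_. undefined\<close>,
  so every sequence of arguments is constant and the differences vanish. With one variable (CH1)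
  says nothing about fixed operators; this fact supplies the hypothesis of
  \<open>DP_everywhereI\<close> in that case.\<close>

lemma fix_only_var_DP_everywhere:
  fixes E :: "nat \<Rightarrow> ('k::real_normed_field, 'a) normed_space"
    and F :: "('k, 'b) normed_space"
  assumes "is_normed_space (E i)" "is_normed_space F"
    and "T \<in> multilin_ops E {i} F" "a \<in> carrier (E i)"
  shows "fix_var E {i} i a T \<in> DP_everywhere E ({i} - {i}) F"
proof -
  let ?S = "fix_var E {i} i a T"
  interpret F: Module.module "ring_of_type_algebra :: 'k ring" F
    using assms(2) by (rule normed_space_module)
  have S: "?S \<in> multilin_ops E ({i} - {i}) F"
    using assms by (intro fix_var_multilin_ops) auto
  then have "?S (\<lambda>_. undefined) \<in> carrier F"
    by (rule multilin_ops_closed) simp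
  then have "nrm F (?S (\<lambda>_. undefined) \<ominus>\<^bsub>F\<^esub> ?S (\<lambda>_. undefined)) = 0"
    using assms(2) by (simp add: is_normed_space_def F.minus_eq F.r_neg)
  then show ?thesis
    using S by (simp add: DP_everywhere_def restrict_def)
qed

section \<open>Equality of the two classes\<close>

text \<open>Strong induction on the number of variables. General finite nonempty index sets are
  allowed because deleting an index from an initial segment need not leave an initial
  segment.\<close>

theorem DP_CH1_eq_DP_everywhere:
  fixes E :: "nat \<Rightarrow> ('k::real_normed_field, 'a) normed_space"
    and F :: "('k, 'b) normed_space"
  assumes "finite I" "I \<noteq> {}"
    and "\<And>i. i \<in> I \<Longrightarrow> is_normed_space (E i)" and F: "is_normed_space F"
  shows "DP_CH1 E I F = DP_everywhere E I F"
  using assms(1-3)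
proof (induction "card I" arbitrary: I rule: less_induct)
  case less
  note E = less.prems(3)
  show ?case
  proof (cases "card I \<ge> 2")
    case True
    have IH: "DP_CH1 E (I - {i}) F = DP_everywhere E (I - {i}) F" if "i \<in> I" for i
    proof (rule less.hyps)
      show "card (I - {i}) < card I"
        using less.prems(1) that by (rule card_Diff1_less)
      \<comment> \<open>Having at least two variables guarantees that one remains, so the induction
        never reaches the empty index set, where the two classes may differ.\<close>
      show "I - {i} \<noteq> {}"
        using True that by (auto simp: card_Diff_singleton dest!: subset_singletonD)
    qed (use less.prems in auto)
    have "DP_CH1 E I F = {T \<in> DP_origin E I F.
        \<forall>i\<in>I. \<forall>a\<in>carrier (E i). fix_var E I i a T \<in> DP_everywhere E (I - {i}) F}"
      using True IH by (subst DP_CH1.simps) auto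
    also have "\<dots> = DP_everywhere E I F"
    proof (intro equalityI subsetI CollectI conjI ballI)
      fix T
      assume T: "T \<in> DP_everywhere E I F"
      then show "T \<in> DP_origin E I F"
        using DP_everywhere_subset_DP_origin[OF E F less.prems(2)] by (rule subsetD[rotated])
      show "fix_var E I i a T \<in> DP_everywhere E (I - {i}) F"
        if "i \<in> I" "a \<in> carrier (E i)" for i a
        using E T that by (rule fix_var_DP_everywhere)
    next
      fix T
      assume "T \<in> {T \<in> DP_origin E I F.
          \<forall>i\<in>I. \<forall>a\<in>carrier (E i). fix_var E I i a T \<in> DP_everywhere E (I - {i}) F}"
      then show "T \<in> DP_everywhere E I F"
        by (intro DP_everywhereI[OF less.prems(1,2) E F]) simp_all
    qed
    finally show ?thesis .
  next
    case False
    moreover have "card I \<noteq> 0"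
      using less.prems by simp
    ultimately have "card I = 1"
      by linarith
    then obtain i where I: "I = {i}"
      by (auto simp: card_1_singleton_iff)
    have "DP_CH1 E I F = DP_origin E I F"
      using False by (subst DP_CH1.simps) simp
    also have "\<dots> = DP_everywhere E I F"
    proof
      show "DP_origin E I F \<subseteq> DP_everywhere E I F"
      proof
        fix T
        assume T: "T \<in> DP_origin E I F"
        then have "T \<in> multilin_ops E {i} F"
          by (simp add: DP_origin_def I)
        then have "fix_var E I k a T \<in> DP_everywhere E (I - {k}) F"
          if "k \<in> I" "a \<in> carrier (E k)" for k a
          using fix_only_var_DP_everywhere[of E i F T a] that E F by (simp add: I)
        then show "T \<in> DP_everywhere E I F"
          using T by (intro DP_everywhereI[OF less.prems(1,2) E F])
      qed
      show "DP_everywhere E I F \<subseteq> DP_origin E I F"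
        using E F less.prems(2) by (rule DP_everywhere_subset_DP_origin)
    qed
    finally show ?thesis .
  qed
qed

theorem theorem2p10:
  fixes E :: "nat \<Rightarrow> ('k::real_normed_field, 'a) normed_space"
    and F :: "('k, 'b) normed_space"
    and m :: nat
  assumes "m \<ge> 1"
    and "\<And>i. i \<in> {1..m} \<Longrightarrow> is_banach_space (E i)"
    and "is_banach_space F"
  shows "DP_CH1 E {1..m} F = DP_everywhere E {1..m} F"
  using assms by (intro DP_CH1_eq_DP_everywhere) (auto simp: is_banach_space_def)

end
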